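(* Let $G=(V,E)$ be a simple graph, $k\ge3$, $\epsilon>0$, $\prec$ a $\frac{1}{1+\epsilon}$-DD order of $G$, and $0<\alpha,\delta<1$. Let $T$ be a positive integer with $$T\ge\frac{12\,((k-1)!)^2(k-1)^{2k-2}(1+\epsilon)^{2k-2}}{\alpha^2(1-\alpha)^2}\ln\frac{4m_k}{\delta}.$$ Then the counter procedure with $T$ samples outputs $\hat\mu_1,\dots,\hat\mu_{m_k}$ such that, with probability at least $1-\delta$, $|\hat\mu_i-\mu_i|\le\alpha$ for every $1\le i\le m_k$, where $(\mu_1,\dots,\mu_{m_k})$ is the $k$-graphlet distribution of $G$.
   Context: A $k$-graphlet of $G$ is a $k$-vertex subset inducing a connected subgraph; $g_1,\dots,g_{m_k}$ are representatives of the isomorphism classes of connected $k$-vertex graphs; $l_i$ is the number of $k$-graphlets of $G$ isomorphic to $g_i$, $L=\sum_i l_i$, and $\mu_i=l_i/L$. For a total order $\prec$ on $V$, $G(v)=G[\{u:v\preceq u\}]$, $d(u\mid G(v))$ is the degree of $u$ in $G(v)$, and $N_v$ is the number of $k$-graphlets of $G(v)$ containing $v$. A $\vartheta$-DD order is a total order such that for all $v$ with $d(v\mid G(v))\ge1$ and all $u\succeq v$, $d(v\mid G(v))\ge\vartheta\,d(u\mid G(v))$. Let $Z=\sum_{v:N_v>0}d(v\mid G(v))^{k-1}$ and define $p(v)=d(v\mid G(v))^{k-1}/Z$ if $N_v>0$, $p(v)=0$ otherwise. Sampling procedure: draw $v$ according to $p$, set $S=\{v\}$, and $k-1$ times pick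 uniformly at random an edge $\{x,y\}$ of $G(v)$ with $x\in S$, $y\notin S$, and add $y$ to $S$; output $S$. $p(S)$ is the probability that this procedure outputs $S$. Counter procedure with $T$ samples: initialize $c_1=\dots=c_{m_k}=0$; $T$ times independently, draw $S$ by the sampling procedure, let $r$ be the index with $G[S]$ isomorphic to $g_r$, and add $1/p(S)$ to $c_r$; output $\hat\mu_i=c_i/\hat C$ where $\hat C=\sum_i c_i$. *)

theory Defs
  imports "HOL-Probability.Probability" "Graph_Theory.Digraph_Isomorphism"
begin

text \<open>
  Finite simple graphs are the \<^emph>\<open>graph\<close> locale of the \<^emph>\<open>Graph_Theory\<close> entry: finite, loop-free,
  symmetric digraphs without parallel arcs. An undirected edge is a pair of opposite arcs, so
  the degree of a vertex is its out-degree. The names \<^emph>\<open>graph\<close> and \<^emph>\<open>connected\<close> are qualified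
  because they clash with constants of HOL.
\<close>

definition connected_graph_of_order :: "nat \<Rightarrow> ('a, 'b) pre_digraph \<Rightarrow> bool" where
  "connected_graph_of_order k H \<longleftrightarrow>
     Digraph.graph H \<and> Digraph_Component.connected H \<and> card (verts H) = k"

text \<open>
  Every finite simple graph is isomorphic to one with natural numbers as vertices and pairs of
  vertices as arcs, so representatives can be taken among these; \<open>m\<close> is then the number of
  isomorphism classes.
\<close>

definition graphlet_representatives ::
    "nat \<Rightarrow> nat \<Rightarrow> (nat \<Rightarrow> (nat, nat \<times> nat) pre_digraph) \<Rightarrow> bool" where
  "graphlet_representatives k m g \<longleftrightarrow>
     (\<forall>i\<in>{1..m}. connected_graph_of_order k (g i)) \<and>
     (\<forall>i\<in>{1..m}. \<forall>j\<in>{1..m}. digraph_iso (g i) (g j) \<longrightarrow> i = j) \<and>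
     (\<forall>H :: (nat, nat \<times> nat) pre_digraph.
        connected_graph_of_order k H \<longrightarrow> (\<exists>i\<in>{1..m}. digraph_iso H (g i)))"

definition graphlets :: "('a, 'b) pre_digraph \<Rightarrow> nat \<Rightarrow> 'a set set" where
  "graphlets G k = {S. S \<subseteq> verts G \<and> card S = k \<and> Digraph_Component.connected (G \<restriction> S)}"

definition graphlet_count ::
    "('a, 'b) pre_digraph \<Rightarrow> nat \<Rightarrow> ('c, 'd) pre_digraph \<Rightarrow> nat" where
  "graphlet_count G k H = card {S \<in> graphlets G k. digraph_iso (G \<restriction> S) H}"

definition graphlet_distribution ::
    "('a, 'b) pre_digraph \<Rightarrow> nat \<Rightarrow> nat \<Rightarrow> (nat \<Rightarrow> ('c, 'd) pre_digraph) \<Rightarrow> nat \<Rightarrow> real" where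
  "graphlet_distribution G k m g i =
     real (graphlet_count G k (g i)) / real (\<Sum>j=1..m. graphlet_count G k (g j))"

text \<open>Throughout, \<open>(u, v) \<in> r\<close> means that \<open>u\<close> precedes or equals \<open>v\<close> in the order.\<close>

definition upper_graph :: "('a, 'b) pre_digraph \<Rightarrow> 'a rel \<Rightarrow> 'a \<Rightarrow> ('a, 'b) pre_digraph" where
  "upper_graph G r v = G \<restriction> {u \<in> verts G. (v, u) \<in> r}"

definition upper_degree :: "('a, 'b) pre_digraph \<Rightarrow> 'a rel \<Rightarrow> 'a \<Rightarrow> 'a \<Rightarrow> nat" where
  "upper_degree G r v u = out_degree (upper_graph G r v) u"

definition dd_order :: "real \<Rightarrow> ('a, 'b) pre_digraph \<Rightarrow> 'a rel \<Rightarrow> bool" where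
  "dd_order \<theta> G r \<longleftrightarrow>
     linear_order_on (verts G) r \<and>
     (\<forall>v\<in>verts G. upper_degree G r v v \<ge> 1 \<longrightarrow>
        (\<forall>u\<in>verts G. (v, u) \<in> r \<longrightarrow>
           real (upper_degree G r v v) \<ge> \<theta> * real (upper_degree G r v u)))"

definition bucket_size :: "('a, 'b) pre_digraph \<Rightarrow> 'a rel \<Rightarrow> nat \<Rightarrow> 'a \<Rightarrow> nat" where
  "bucket_size G r k v = card {S \<in> graphlets (upper_graph G r v) k. v \<in> S}"

definition start_norm :: "('a, 'b) pre_digraph \<Rightarrow> 'a rel \<Rightarrow> nat \<Rightarrow> real" where
  "start_norm G r k =
     (\<Sum>v | v \<in> verts G \<and> bucket_size G r k v > 0. real (upper_degree G r v v) ^ (k - 1))"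

definition start_weight :: "('a, 'b) pre_digraph \<Rightarrow> 'a rel \<Rightarrow> nat \<Rightarrow> 'a \<Rightarrow> real" where
  "start_weight G r k v =
     (if bucket_size G r k v > 0
      then real (upper_degree G r v v) ^ (k - 1) / start_norm G r k else 0)"

text \<open>
  In a simple graph every edge with exactly one endpoint in \<open>S\<close> has exactly one of its two arcs
  leaving \<open>S\<close>, so a uniform arc leaving \<open>S\<close> is a uniform edge of the cut.
\<close>

definition cut_arcs :: "('a, 'b) pre_digraph \<Rightarrow> 'a set \<Rightarrow> 'b set" where
  "cut_arcs H S = {e \<in> arcs H. tail H e \<in> S \<and> head H e \<notin> S}"

primrec grow :: "('a, 'b) pre_digraph \<Rightarrow> nat \<Rightarrow> 'a set \<Rightarrow> 'a set pmf" where
  "grow H 0 S = return_pmf S"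
| "grow H (Suc n) S = do { e \<leftarrow> pmf_of_set (cut_arcs H S); grow H n (insert (head H e) S) }"

text \<open>
  \<open>embed_pmf\<close> is meaningful here only if the weights sum to 1, i.e. if \<open>G\<close> has a \<open>k\<close>-graphlet.
  The cut is never empty before \<open>k\<close> vertices are reached, since the start vertex lies in a
  \<open>k\<close>-graphlet of its upper graph.
\<close>

definition sample_graphlet :: "('a, 'b) pre_digraph \<Rightarrow> 'a rel \<Rightarrow> nat \<Rightarrow> 'a set pmf" where
  "sample_graphlet G r k =
     do { v \<leftarrow> embed_pmf (start_weight G r k); grow (upper_graph G r v) (k - 1) {v} }"

definition graphlet_index ::
    "('a, 'b) pre_digraph \<Rightarrow> nat \<Rightarrow> (nat \<Rightarrow> ('c, 'd) pre_digraph) \<Rightarrow> 'a set \<Rightarrow> nat" where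
  "graphlet_index G m g S = (THE i. i \<in> {1..m} \<and> digraph_iso (G \<restriction> S) (g i))"

primrec counters ::
    "('a, 'b) pre_digraph \<Rightarrow> 'a rel \<Rightarrow> nat \<Rightarrow> nat \<Rightarrow> (nat \<Rightarrow> ('c, 'd) pre_digraph) \<Rightarrow> nat
      \<Rightarrow> (nat \<Rightarrow> real) pmf" where
  "counters G r k m g 0 = return_pmf (\<lambda>_. 0)"
| "counters G r k m g (Suc t) =
     do { c \<leftarrow> counters G r k m g t;
          S \<leftarrow> sample_graphlet G r k;
          let i = graphlet_index G m g S;
          return_pmf (c(i := c i + 1 / pmf (sample_graphlet G r k) S)) }"

definition estimate ::
    "('a, 'b) pre_digraph \<Rightarrow> 'a rel \<Rightarrow> nat \<Rightarrow> nat \<Rightarrow> (nat \<Rightarrow> ('c, 'd) pre_digraph) \<Rightarrow> nat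
      \<Rightarrow> (nat \<Rightarrow> real) pmf" where
  "estimate G r k m g T =
     map_pmf (\<lambda>c i. c i / (\<Sum>j=1..m. c j)) (counters G r k m g T)"

end

theory Submission
  imports Defs
begin

text \<open>
  Let \<open>L\<close> be the number of \<open>k\<close>-graphlets and \<open>d\<close> the degree of \<open>v\<close> in its upper graph.
  In a \<open>1/(1+\<epsilon>)\<close>-DD order a set of \<open>j\<close> vertices has at most \<open>j (1+\<epsilon>) d\<close> arcs leaving it, so each
  graphlet whose least vertex is \<open>v\<close> is grown from \<open>v\<close> with probability at least
  \<open>1 / ((k-1)! ((1+\<epsilon>) d)^(k-1))\<close>; the start weights cancel \<open>d^(k-1)\<close>, so \<open>1/p(S)\<close> is at most
  \<open>B = Z (k-1)! (1+\<epsilon>)^(k-1)\<close>. Counting stars centred at \<open>v\<close> gives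
  \<open>N_v \<ge> (d/(k-1))^(k-1)\<close>, hence \<open>Z \<le> (k-1)^(k-1) L\<close>. For every set \<open>J\<close> of indices, the sum
  of the counters in \<open>J\<close> is therefore a sum of \<open>T\<close> independent variables with values in \<open>[0, B]\<close>
  and mean the number of graphlets of a type in \<open>J\<close>. Hoeffding's inequality applied to each
  singleton and to \<open>{1..m}\<close>, with deviation \<open>\<alpha> L / 3\<close>, and a union bound conclude.
\<close>

subsection \<open>Connected sets and the growth process\<close>

hide_const (open) Topological_Spaces.connected

lemma induce_induce [simp]: "S \<subseteq> U \<Longrightarrow> (H \<restriction> U) \<restriction> S = H \<restriction> S"
  by (auto simp: induce_subgraph_def)

lemma connected_singleton: "connected (H \<restriction> {v})"
  by (auto simp: connected_conv)

text \<open>Walks inside \<open>S\<close> survive in the larger induced subgraph, and the arc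
  \<open>e\<close> joins the new vertex to them. Any two vertices are therefore connected through
  \<open>tail H e\<close>.\<close>

lemma connected_insert:
  assumes conn: "connected (H \<restriction> S)" and e: "e \<in> arcs H" "tail H e \<in> S"
  shows "connected (H \<restriction> insert (head H e) S)"
proof -
  let ?y = "head H e" and ?K = "H \<restriction> insert (head H e) S"
  let ?R = "rtrancl_on (insert ?y S) ((arcs_ends ?K)\<^sup>s)"
  have sub: "(arcs_ends (H \<restriction> S))\<^sup>s \<subseteq> (arcs_ends ?K)\<^sup>s"
    by (auto simp: arcs_ends_conv symcl_def)
  have S: "(u, v) \<in> ?R" if "u \<in> S" "v \<in> S" for u v
  proof -
    have "(u, v) \<in> rtrancl_on S ((arcs_ends (H \<restriction> S))\<^sup>s)"
      using conn that by (auto simp: connected_conv)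
    then show ?thesis
    proof (induct rule: rtrancl_on_induct)
      case (step y z)
      then show ?case using sub by (blast intro: rtrancl_on_into_rtrancl_on)
    qed (use that in auto)
  qed
  have ends: "(tail H e, ?y) \<in> (arcs_ends ?K)\<^sup>s" "(?y, tail H e) \<in> (arcs_ends ?K)\<^sup>s"
    using e by (auto simp: arcs_ends_conv symcl_def intro!: rev_image_eqI)
  have "(u, v) \<in> ?R" if "u \<in> insert ?y S" "v \<in> insert ?y S" for u v
  proof -
    have "(u, tail H e) \<in> ?R"
      using S[of u "tail H e"] ends(2) e that
      by (auto intro: rtrancl_on_into_rtrancl_on[OF rtrancl_on_refl])
    moreover have "(tail H e, v) \<in> ?R"
      using S[of "tail H e" v] ends(1) e that
      by (auto intro: rtrancl_on_into_rtrancl_on[OF rtrancl_on_refl])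
    ultimately show ?thesis by (rule rtrancl_on_trans)
  qed
  then show ?thesis by (auto simp: connected_conv)
qed

text \<open>A walk inside \<open>W\<close> from \<open>a\<close> to \<open>b\<close> has to leave
  \<open>A\<close>. Connectivity only gives steps in the symmetric closure; symmetry of
  \<open>H\<close> supplies an arc in the outward direction.\<close>

lemma connected_crossing_arc:
  assumes "symmetric H" and conn: "connected (H \<restriction> W)"
    and a: "a \<in> A" "a \<in> W" and b: "b \<in> W" "b \<notin> A"
  obtains e where "e \<in> arcs H" "tail H e \<in> A" "head H e \<in> W - A"
proof -
  have "(a, b) \<in> rtrancl_on W ((arcs_ends (H \<restriction> W))\<^sup>s)"
    using conn a b by (auto simp: connected_conv)
  \<comment> \<open>Induction along the walk: nothing is claimed while its end is still in
    \<open>A\<close>, and the first step out of \<open>A\<close> is the required arc.\<close>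
  then have "b \<notin> A \<longrightarrow> (\<exists>e \<in> arcs H. tail H e \<in> A \<and> head H e \<in> W - A)"
  proof (induct rule: rtrancl_on_induct)
    case base
    then show ?case using a by auto
  next
    case (step y z)
    have "\<exists>e \<in> arcs H. tail H e = y \<and> head H e = z"
      using step(2) \<open>symmetric H\<close>
      by (fastforce simp: symcl_def arcs_ends_conv symmetric_conv)
    then show ?case using step by auto
  qed
  then show thesis using b that by blast
qed

lemma graph_induce_subgraph:
  assumes "graph G" "U \<subseteq> verts G"
  shows "graph (G \<restriction> U)"
proof -
  interpret graph G by fact
  have ind: "induced_subgraph (G \<restriction> U) G" using assms by auto
  show ?thesis
    using digraphI_induced[OF ind] induced_graph_imp_symmetric[OF sym_arcs ind]
    by (rule digraph.graphI)
qed

lemma finite_cut_arcs: "finite (arcs H) \<Longrightarrow> finite (cut_arcs H S)"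
  by (auto simp: cut_arcs_def)

text \<open>The set \<open>W\<close> only witnesses that growth cannot get stuck. It shares
  \<open>v\<close> with \<open>S\<close> and is larger than \<open>S\<close>, so some arc of
  \<open>W\<close> leaves \<open>S\<close>; the cut is then nonempty and \<open>pmf_of_set\<close>
  is meaningful.\<close>

lemma set_pmf_grow:
  assumes H: "graph H" and W: "connected (H \<restriction> W)" "v \<in> W"
    and S: "S \<subseteq> verts H" "connected (H \<restriction> S)" "v \<in> S"
    and card: "card W = card S + n" and S': "S' \<in> set_pmf (grow H n S)"
  shows "S' \<subseteq> verts H \<and> v \<in> S' \<and> card S' = card W \<and> connected (H \<restriction> S')"
  using S card S'
proof (induction n arbitrary: S)
  case (Suc n)
  interpret graph H by fact
  have "finite S" using Suc.prems(1) finite_verts by (rule finite_subset)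
  have "\<not> W \<subseteq> S"
    using card_mono[OF \<open>finite S\<close>, of W] Suc.prems by auto
  then obtain b where "b \<in> W" "b \<notin> S" by auto
  with connected_crossing_arc[OF sym_arcs W(1) \<open>v \<in> S\<close> W(2)]
  obtain e where "e \<in> cut_arcs H S" unfolding cut_arcs_def by blast
  then have "set_pmf (pmf_of_set (cut_arcs H S)) = cut_arcs H S"
    by (intro set_pmf_of_set finite_cut_arcs) auto
  then obtain e where e: "e \<in> arcs H" "tail H e \<in> S" "head H e \<notin> S"
    "S' \<in> set_pmf (grow H n (insert (head H e) S))"
    using Suc.prems by (auto simp: cut_arcs_def)
  show ?case
    using Suc.IH[of "insert (head H e) S"] Suc.prems e \<open>finite S\<close> connected_insert[of H S e]
    by auto
qed auto

lemma card_cut_arcs_le: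
  assumes "fin_digraph H" "finite S" "\<And>u. u \<in> S \<Longrightarrow> real (out_degree H u) \<le> D"
  shows "real (card (cut_arcs H S)) \<le> real (card S) * D"
proof -
  interpret fin_digraph H by fact
  have "card (cut_arcs H S) \<le> card (\<Union>u\<in>S. out_arcs H u)"
    using assms by (intro card_mono) (auto simp: cut_arcs_def out_arcs_def)
  also have "\<dots> \<le> (\<Sum>u\<in>S. out_degree H u)"
    unfolding out_degree_def using assms(2) by (rule card_UN_le)
  finally have "real (card (cut_arcs H S)) \<le> (\<Sum>u\<in>S. real (out_degree H u))"
    by (simp flip: of_nat_sum)
  also have "\<dots> \<le> (\<Sum>u\<in>S. D)"
    using assms(3) by (rule sum_mono)
  finally show ?thesis by simp
qed

text \<open>While \<open>S\<close> is a proper subset of \<open>W\<close>, some arc of the cut leads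
  into \<open>W\<close>. It is chosen with probability at least \<open>1 / (card S * D)\<close>, and
  these factors multiply over the successive sizes of \<open>S\<close>.\<close>

lemma pmf_grow_ge:
  assumes H: "graph H" and W: "connected (H \<restriction> W)" "finite W"
    and D: "\<And>u. u \<in> W \<Longrightarrow> real (out_degree H u) \<le> D"
    and S: "S \<subseteq> W" "S \<noteq> {}" "card W = card S + n"
  shows "pmf (grow H n S) W \<ge> 1 / (\<Prod>j = card S..<card W. real j * D)"
  using S
proof (induction n arbitrary: S)
  case 0
  then have "S = W" using W card_subset_eq by (metis add.right_neutral)
  then show ?case by simp
next
  case (Suc n)
  interpret graph H by fact
  let ?C = "cut_arcs H S" and ?P = "\<Prod>j = card S..<card W. real j * D"
  have finS: "finite S" using Suc.prems W finite_subset by auto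
  obtain a where a: "a \<in> S" "a \<in> W" using Suc.prems by auto
  obtain b where b: "b \<in> W" "b \<notin> S" using Suc.prems by (metis add_cancel_right_right nat.simps(3) subsetI subset_antisym)
  obtain e where e: "e \<in> arcs H" "tail H e \<in> S" "head H e \<in> W - S"
    by (rule connected_crossing_arc[OF sym_arcs W(1) a b])
  have C: "finite ?C" "e \<in> ?C" using e by (auto simp: cut_arcs_def)
  then have "card ?C > 0" by (auto simp: card_gt_0_iff)
  have D0: "D \<ge> 0" using D[OF a(2)] by linarith
  have cutle: "real (card ?C) \<le> real (card S) * D"
    using Suc.prems D finS by (intro card_cut_arcs_le) (auto intro: fin_digraph)
  let ?S' = "insert (head H e) S"
  let ?P' = "\<Prod>j = Suc (card S)..<card W. real j * D"
  have cS': "card ?S' = Suc (card S)" using e finS by simp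
  have "?P = real (card S) * D * ?P'"
    using Suc.prems by (intro prod.atLeast_Suc_lessThan) auto
  then have "1 / ?P = (1 / ?P') / (real (card S) * D)"
    by simp
  also have "\<dots> \<le> (1 / ?P') / real (card ?C)"
    using cutle \<open>card ?C > 0\<close> D0 by (intro divide_left_mono) (auto intro!: prod_nonneg mult_pos_pos)
  also have "\<dots> \<le> pmf (grow H n ?S') W / real (card ?C)"
    using Suc.IH[of ?S'] cS' Suc.prems e by (intro divide_right_mono) auto
  \<comment> \<open>Among all ways to continue, only the arc \<open>e\<close> into \<open>W\<close>
    is kept.\<close>
  also have "\<dots> \<le> (\<Sum>e\<in>?C. pmf (grow H n (insert (head H e) S)) W) / real (card ?C)"
    using C by (intro divide_right_mono member_le_sum) auto
  also have "\<dots> = pmf (grow H (Suc n) S) W"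
    using C by (subst grow.simps, subst pmf_bind_pmf_of_set) auto
  finally show ?case .
qed

subsection \<open>Graphlets and their isomorphism types\<close>

lemma graphletsD:
  assumes "S \<in> graphlets G k"
  shows "S \<subseteq> verts G" "card S = k" "connected (G \<restriction> S)"
  using assms by (auto simp: graphlets_def)

lemma finite_graphlets: "finite (verts G) \<Longrightarrow> finite (graphlets G k)"
  by (rule finite_subset[of _ "Pow (verts G)"]) (auto simp: graphlets_def)

text \<open>Moves a graph to the type of the representatives, where their completeness is stated.
  Vertices are numbered injectively and each arc becomes its pair of ends, which is injective
  because there are no parallel arcs.\<close>

lemma graph_isomorphic_to_nat_graph:
  fixes K :: "('a, 'b) pre_digraph"
  assumes "graph K" and conn: "connected K"
  obtains H :: "(nat, nat \<times> nat) pre_digraph"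
    where "digraph_iso K H" "graph H" "connected H" "card (verts H) = card (verts K)"
proof -
  interpret K: graph K by fact
  obtain f :: "'a \<Rightarrow> nat" where f: "inj_on f (verts K)"
    using finite_imp_inj_to_nat_seg[OF K.finite_verts] by blast
  define h where "h = \<lparr>iso_verts = f, iso_arcs = (\<lambda>e. (f (tail K e), f (head K e))),
    iso_head = snd, iso_tail = fst\<rparr>"
  have "inj_on (\<lambda>e. (f (tail K e), f (head K e))) (arcs K)"
    using f by (auto intro!: inj_onI K.no_multi_arcs simp: arc_to_ends_def inj_on_eq_iff)
  then have h: "K.digraph_isomorphism h"
    using f by (auto simp: K.digraph_isomorphism_def h_def K.wf_digraph)
  let ?H = "app_iso h K"
  interpret H: fin_digraph ?H using h by (rule K.fin_digraphI_app_iso)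
  have "graph ?H"
  proof
    fix e assume "e \<in> arcs ?H"
    then show "tail ?H e \<noteq> head ?H e"
      using f K.no_loops by (auto simp: h_def inj_on_eq_iff)
  next
    fix e e' assume "e \<in> arcs ?H" "e' \<in> arcs ?H" "arc_to_ends ?H e = arc_to_ends ?H e'"
    then show "e = e'" by (auto simp: h_def arc_to_ends_def)
  next
    show "symmetric ?H"
      using K.sym_arcs by (fastforce simp: h_def symmetric_conv)
  qed
  moreover have "digraph_iso K ?H" using h by (auto simp: digraph_iso_def)
  moreover have "connected ?H" using conn h by (rule K.connectedI_app_iso)
  moreover have "card (verts ?H) = card (verts K)" using f by (simp add: h_def card_image)
  ultimately show thesis using that by blast
qed

text \<open>Justifies the \<open>THE\<close> in \<open>graphlet_index\<close>. Existence passes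
  through a copy on natural numbers; for uniqueness, two representatives isomorphic to the same
  subgraph are isomorphic to each other.\<close>

lemma ex1_graphlet_representative:
  assumes "graph G" and g: "graphlet_representatives k m g" and S: "S \<in> graphlets G k"
  shows "\<exists>!i. i \<in> {1..m} \<and> digraph_iso (G \<restriction> S) (g i)"
proof -
  interpret K: graph "G \<restriction> S"
    using assms graphletsD(1) by (intro graph_induce_subgraph)
  obtain H :: "(nat, nat \<times> nat) pre_digraph" where H: "digraph_iso (G \<restriction> S) H" "graph H"
    "connected H" "card (verts H) = card (verts (G \<restriction> S))"
    by (rule graph_isomorphic_to_nat_graph[OF K.graph_axioms graphletsD(3)[OF S]])
  then have "connected_graph_of_order k H"
    using graphletsD[OF S] by (simp add: connected_graph_of_order_def)
  with g have "\<exists>i\<in>{1..m}. digraph_iso H (g i)"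
    unfolding graphlet_representatives_def by blast
  then obtain i where i: "i \<in> {1..m}" "digraph_iso H (g i)" by blast
  have "i \<in> {1..m} \<and> digraph_iso (G \<restriction> S) (g i)"
    using i(1) digraph_iso_trans[OF H(1) i(2)] by blast
  moreover have "i = j" if i: "i \<in> {1..m} \<and> digraph_iso (G \<restriction> S) (g i)"
    and j: "j \<in> {1..m} \<and> digraph_iso (G \<restriction> S) (g j)" for i j
  proof -
    have "digraph_iso (g i) (g j)"
      by (rule digraph_iso_trans[OF digraph_iso_swap[OF K.wf_digraph conjunct2[OF i]] conjunct2[OF j]])
    with g i j show ?thesis unfolding graphlet_representatives_def by blast
  qed
  ultimately show ?thesis by blast
qed

lemma graphlet_index_eq_iff:
  assumes "graph G" "graphlet_representatives k m g" "S \<in> graphlets G k" "i \<in> {1..m}"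
  shows "graphlet_index G m g S = i \<longleftrightarrow> digraph_iso (G \<restriction> S) (g i)"
  unfolding graphlet_index_def
  using the1_equality[OF ex1_graphlet_representative[OF assms(1-3)]]
    theI'[OF ex1_graphlet_representative[OF assms(1-3)]] assms(4)
  by blast

lemma graphlet_index_in:
  assumes "graph G" "graphlet_representatives k m g" "S \<in> graphlets G k"
  shows "graphlet_index G m g S \<in> {1..m}"
  unfolding graphlet_index_def
  using theI'[OF ex1_graphlet_representative[OF assms]] by blast

text \<open>The index partitions the graphlets into isomorphism classes. A singleton
  \<open>J\<close> gives one count and \<open>{1..m}\<close> gives the total.\<close>

lemma sum_graphlet_count:
  assumes G: "graph G" and g: "graphlet_representatives k m g" and J: "J \<subseteq> {1..m}"
  shows "(\<Sum>j\<in>J. graphlet_count G k (g j)) = card {S \<in> graphlets G k. graphlet_index G m g S \<in> J}"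
proof -
  interpret graph G by fact
  have "(\<Sum>j\<in>J. graphlet_count G k (g j))
      = (\<Sum>j\<in>J. card {S \<in> graphlets G k. graphlet_index G m g S = j})"
    unfolding graphlet_count_def
    using J graphlet_index_eq_iff[OF G g] by (intro sum.cong arg_cong[where f = card]) blast+
  also have "\<dots> = card (\<Union>j\<in>J. {S \<in> graphlets G k. graphlet_index G m g S = j})"
    using finite_graphlets[of G k] finite_subset[OF J]
    by (intro card_UN_disjoint[symmetric]) auto
  also have "(\<Union>j\<in>J. {S \<in> graphlets G k. graphlet_index G m g S = j})
      = {S \<in> graphlets G k. graphlet_index G m g S \<in> J}" by auto
  finally show ?thesis .
qed

subsection \<open>Buckets and the normalising constant\<close>

lemma linear_order_on_ex_min:
  assumes r: "linear_order_on A r" and "finite S" "S \<noteq> {}" "S \<subseteq> A"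
  shows "\<exists>v\<in>S. \<forall>u\<in>S. (v, u) \<in> r"
  using assms(2-)
proof (induction rule: finite_ne_induct)
  case (singleton x)
  then show ?case using r by (auto simp: order_on_defs refl_on_def)
next
  case (insert x F)
  then obtain v where v: "v \<in> F" "\<forall>u\<in>F. (v, u) \<in> r" by auto
  have "(x, x) \<in> r" "(v, x) \<in> r \<or> (x, v) \<in> r"
    using r v insert by (auto simp: order_on_defs refl_on_def total_on_def)
  moreover have "trans r" using r by (auto simp: order_on_defs)
  ultimately show ?case using v by (auto dest: transD)
qed

definition bucket :: "('a, 'b) pre_digraph \<Rightarrow> 'a rel \<Rightarrow> nat \<Rightarrow> 'a \<Rightarrow> 'a set set" where
  "bucket G r k v = {S \<in> graphlets (upper_graph G r v) k. v \<in> S}"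

lemma bucket_size_eq: "bucket_size G r k v = card (bucket G r k v)"
  by (simp add: bucket_size_def bucket_def)

text \<open>Inducing on \<open>S\<close> within the upper graph agrees with inducing on
  \<open>S\<close> in \<open>G\<close>, so buckets sort the graphlets of \<open>G\<close> by least
  vertex.\<close>

lemma in_bucket_iff:
  "S \<in> bucket G r k v \<longleftrightarrow> S \<in> graphlets G k \<and> v \<in> S \<and> (\<forall>u\<in>S. (v, u) \<in> r)"
proof (cases "S \<subseteq> {u \<in> verts G. (v, u) \<in> r}")
  case True
  then show ?thesis by (auto simp: bucket_def graphlets_def upper_graph_def)
qed (auto simp: bucket_def graphlets_def upper_graph_def)

lemma finite_bucket: "finite (verts G) \<Longrightarrow> finite (bucket G r k v)"
  by (rule finite_subset[OF _ finite_graphlets[of G k]]) (auto simp: in_bucket_iff)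

text \<open>By antisymmetry a graphlet has only one least vertex, so the buckets are
  disjoint.\<close>

lemma sum_bucket_size_le:
  assumes r: "linear_order_on (verts G) r" and fin: "finite (verts G)" and A: "A \<subseteq> verts G"
  shows "(\<Sum>v\<in>A. bucket_size G r k v) \<le> card (graphlets G k)"
proof -
  have "antisym r" using r by (simp add: order_on_defs)
  then have "bucket G r k v \<inter> bucket G r k w = {}" if "v \<noteq> w" for v w
    using that by (fastforce simp: in_bucket_iff dest: antisymD)
  then have "(\<Sum>v\<in>A. bucket_size G r k v) = card (\<Union>v\<in>A. bucket G r k v)"
    unfolding bucket_size_eq using fin finite_bucket[OF fin] finite_subset[OF A]
    by (intro card_UN_disjoint[symmetric]) auto
  also have "\<dots> \<le> card (graphlets G k)"
    using finite_graphlets[OF fin] by (intro card_mono) (auto simp: in_bucket_iff)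
  finally show ?thesis .
qed

lemma graphlet_in_bucket:
  assumes "linear_order_on (verts G) r" "finite (verts G)" "S \<in> graphlets G k" "k > 0"
  obtains v where "v \<in> verts G" "S \<in> bucket G r k v"
proof -
  have "finite S" "S \<noteq> {}" "S \<subseteq> verts G"
    using assms finite_subset by (auto simp: graphlets_def)
  from linear_order_on_ex_min[OF assms(1) this] show thesis
    using that assms(3) \<open>S \<subseteq> verts G\<close> by (auto simp: in_bucket_iff)
qed

text \<open>Any \<open>n\<close> neighbours of \<open>v\<close> together with \<open>v\<close>
  contain a spanning star and are thus connected; different choices of neighbours give different
  sets.\<close>

lemma star_graphlets:
  assumes "graph H" and v: "v \<in> verts H"
  shows "out_degree H v choose n \<le> card {S \<in> graphlets H (Suc n). v \<in> S}"
proof -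
  interpret graph H by fact
  let ?N = "head H ` out_arcs H v"
  have vN: "v \<notin> ?N" using no_loops by (auto simp: out_arcs_def)
  have "inj_on (head H) (out_arcs H v)"
    by (auto intro!: inj_onI no_multi_arcs simp: out_arcs_def arc_to_ends_def)
  then have cN: "card ?N = out_degree H v"
    by (simp add: card_image out_degree_def)
  \<comment> \<open>The leaves of the star are attached one at a time.\<close>
  have conn: "connected (H \<restriction> insert v A)" if "finite A" "A \<subseteq> ?N" for A
    using that
  proof induction
    case (insert x A)
    then obtain e where "e \<in> arcs H" "tail H e = v" "x = head H e" by (auto simp: out_arcs_def)
    with insert connected_insert[of H "insert v A" e] show ?case by (auto simp: insert_commute)
  qed (simp add: connected_singleton)
  have "out_degree H v choose n = card {A. A \<subseteq> ?N \<and> card A = n}"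
    using cN by (subst n_subsets) (auto intro: finite_out_arcs)
  also have "\<dots> = card (insert v ` {A. A \<subseteq> ?N \<and> card A = n})"
  proof (intro card_image[symmetric] inj_onI)
    fix A B assume "A \<in> {A. A \<subseteq> ?N \<and> card A = n}" "B \<in> {A. A \<subseteq> ?N \<and> card A = n}"
      and eq: "insert v A = insert v B"
    then have "v \<notin> A" "v \<notin> B" using vN by auto
    with eq show "A = B" by (simp add: insert_ident)
  qed
  also have "\<dots> \<le> card {S \<in> graphlets H (Suc n). v \<in> S}"
  proof (rule card_mono)
    show "finite {S \<in> graphlets H (Suc n). v \<in> S}" using finite_graphlets[of H] by auto
    show "insert v ` {A. A \<subseteq> ?N \<and> card A = n} \<subseteq> {S \<in> graphlets H (Suc n). v \<in> S}"
    proof safe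
      fix A assume A: "A \<subseteq> ?N" "n = card A"
      have "finite ?N" by (auto intro: finite_out_arcs)
      with A have "finite A" by (auto intro: finite_subset)
      moreover have "v \<notin> A" "A \<subseteq> verts H" using A vN by (auto simp: out_arcs_def)
      ultimately show "insert v A \<in> graphlets H (Suc (card A))"
        using A conn v vN by (auto simp: graphlets_def)
    qed
  qed
  finally show ?thesis .
qed

lemma graph_upper_graph: "graph G \<Longrightarrow> graph (upper_graph G r v)"
  unfolding upper_graph_def by (rule graph_induce_subgraph) auto

lemma in_verts_upper_graph:
  "linear_order_on (verts G) r \<Longrightarrow> v \<in> verts G \<Longrightarrow> v \<in> verts (upper_graph G r v)"
  by (auto simp: upper_graph_def order_on_defs refl_on_def)

text \<open>With at least \<open>n\<close> neighbours, the star count and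
  \<open>(d/n)^n \<le> (d choose n)\<close> give the bound.\<close>

lemma upper_degree_power_le:
  assumes G: "graph G" and r: "linear_order_on (verts G) r" and v: "v \<in> verts G"
    and pos: "bucket_size G r (Suc n) v > 0"
  shows "real (upper_degree G r v v) ^ n \<le> real n ^ n * real (bucket_size G r (Suc n) v)"
proof -
  let ?d = "upper_degree G r v v" and ?N = "bucket_size G r (Suc n) v"
  show ?thesis
  proof (cases "n \<le> ?d \<and> n > 0")
    case True
    then have "(real ?d / real n) ^ n \<le> real (?d choose n)"
      by (intro binomial_ge_n_over_k_pow_k) auto
    also have "\<dots> \<le> real ?N"
      using star_graphlets[OF graph_upper_graph[OF G] in_verts_upper_graph[OF r v]]
      by (simp add: upper_degree_def bucket_size_def)
    finally show ?thesis using True by (simp add: field_simps power_divide)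
  next
    \<comment> \<open>With fewer than \<open>n\<close> neighbours, or \<open>n = 0\<close>, the
      power is at most \<open>n^n\<close>, and the bucket contains at least one graphlet.\<close>
    case False
    then have "real ?d ^ n \<le> real n ^ n" by (cases "n = 0") (auto intro: power_mono)
    also have "\<dots> \<le> real n ^ n * real ?N" using pos by (simp add: mult_le_cancel_left1)
    finally show ?thesis .
  qed
qed

lemma start_norm_le:
  assumes G: "graph G" and r: "linear_order_on (verts G) r"
  shows "start_norm G r (Suc n) \<le> real n ^ n * real (card (graphlets G (Suc n)))"
proof -
  interpret graph G by fact
  let ?V = "{v. v \<in> verts G \<and> bucket_size G r (Suc n) v > 0}"
  have "start_norm G r (Suc n) \<le> (\<Sum>v\<in>?V. real n ^ n * real (bucket_size G r (Suc n) v))"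
    unfolding start_norm_def using upper_degree_power_le[OF G r]
    by (auto intro!: sum_mono)
  also have "\<dots> = real n ^ n * real (\<Sum>v\<in>?V. bucket_size G r (Suc n) v)"
    by (simp add: sum_distrib_left)
  also have "\<dots> \<le> real n ^ n * real (card (graphlets G (Suc n)))"
    by (intro mult_left_mono of_nat_mono sum_bucket_size_le[OF r]) auto
  finally show ?thesis .
qed

text \<open>A connected set of at least two vertices has an arc leaving \<open>v\<close>. This
  activates the condition of the DD order at \<open>v\<close> and makes the start weight
  positive.\<close>

lemma upper_degree_pos:
  assumes G: "graph G" and S: "S \<in> bucket G r k v" and k: "k \<ge> 2"
  shows "upper_degree G r v v > 0"
proof -
  interpret H: graph "upper_graph G r v" using G by (rule graph_upper_graph)
  have S': "connected (upper_graph G r v \<restriction> S)" "card S = k" "v \<in> S"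
    using S by (auto simp: bucket_def graphlets_def)
  have "\<not> S \<subseteq> {v}" using S' k card_mono[of "{v}" S] by auto
  then obtain b where b: "b \<in> S" "b \<notin> {v}" by auto
  from connected_crossing_arc[OF H.sym_arcs S'(1) singletonI S'(3) b]
  obtain e where "e \<in> out_arcs (upper_graph G r v) v" by (auto simp: out_arcs_def)
  then show ?thesis
    using H.finite_out_arcs[of v] by (auto simp: upper_degree_def out_degree_def card_gt_0_iff)
qed

subsection \<open>The sampling distribution\<close>

text \<open>Retains a single outcome \<open>v\<close> of the first draw.\<close>

lemma pmf_bind_ge: "pmf N v * pmf (f v) x \<le> pmf (bind_pmf N f) x"
proof -
  have "pmf N v * pmf (f v) x = (\<integral>y. indicator {v} y * pmf (f v) x \<partial>N)"
    by (simp add: measure_pmf_single)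
  also have "\<dots> \<le> (\<integral>y. pmf (f y) x \<partial>N)"
    by (intro integral_mono measure_pmf.integrable_const_bound[where B = 1])
       (auto simp: pmf_le_1 indicator_def)
  finally show ?thesis by (simp add: pmf_bind)
qed

text \<open>Here \<open>n\<close> is \<open>k - 1\<close>, the number of growth steps. The existence
  of a graphlet makes \<open>Z\<close> positive.\<close>

locale dd_sampling =
  fixes G :: "('a, 'b) pre_digraph" and r :: "'a rel" and n :: nat and \<epsilon> :: real
  assumes graph: "graph G" and n: "n \<ge> 1" and graphlets_ne: "graphlets G (Suc n) \<noteq> {}"
    and eps: "\<epsilon> > 0" and dd: "dd_order (1 / (1 + \<epsilon>)) G r"
begin

sublocale graph G by (rule graph)

abbreviation "sample \<equiv> sample_graphlet G r (Suc n)"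
abbreviation "Z \<equiv> start_norm G r (Suc n)"

text \<open>This is the bound \<open>B\<close> on \<open>1/p(S)\<close>, hence the range of the
  summands in Hoeffding's inequality.\<close>

definition inv_pmf_bound :: real where
  "inv_pmf_bound = Z * fact n * (1 + \<epsilon>) ^ n"

lemma order: "linear_order_on (verts G) r"
  using dd by (simp add: dd_order_def)

lemma bucket_size_pos: "S \<in> bucket G r (Suc n) v \<Longrightarrow> bucket_size G r (Suc n) v > 0"
  using finite_bucket[OF finite_verts] by (auto simp: bucket_size_eq card_gt_0_iff)

lemma Z_pos: "Z > 0"
proof -
  obtain S where "S \<in> graphlets G (Suc n)" using graphlets_ne by auto
  then obtain v where v: "v \<in> verts G" "S \<in> bucket G r (Suc n) v"
    using graphlet_in_bucket[OF order finite_verts] by blast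
  have "real (upper_degree G r v v) ^ n > 0"
    using upper_degree_pos[OF graph v(2)] n by simp
  then show ?thesis
    unfolding start_norm_def using v bucket_size_pos[OF v(2)]
    by (intro sum_pos2[of _ v]) auto
qed

lemma inv_pmf_bound_pos: "inv_pmf_bound > 0"
  unfolding inv_pmf_bound_def using Z_pos eps by simp

lemma start_weight_outside: "v \<notin> verts G \<Longrightarrow> start_weight G r (Suc n) v = 0"
proof -
  assume v: "v \<notin> verts G"
  have "bucket G r (Suc n) v = {}" using v by (auto simp: in_bucket_iff graphlets_def)
  then show ?thesis by (simp add: start_weight_def bucket_size_eq)
qed

text \<open>Total mass 1 is the condition under which \<open>embed_pmf\<close> has the prescribed
  weights.\<close>

lemma nn_integral_start_weight:
  "(\<integral>\<^sup>+v. ennreal (start_weight G r (Suc n) v) \<partial>count_space UNIV) = 1"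
proof -
  have nonneg: "start_weight G r (Suc n) v \<ge> 0" for v
    using Z_pos by (simp add: start_weight_def)
  have "(\<Sum>v\<in>verts G. start_weight G r (Suc n) v)
      = (\<Sum>v | v \<in> verts G \<and> bucket_size G r (Suc n) v > 0. real (upper_degree G r v v) ^ n / Z)"
    by (simp add: start_weight_def sum.inter_filter cong: if_cong)
  also have "\<dots> = Z / Z"
    unfolding sum_divide_distrib[symmetric] by (simp add: start_norm_def)
  finally have "(\<Sum>v\<in>verts G. start_weight G r (Suc n) v) = 1" using Z_pos by simp
  moreover have "(\<integral>\<^sup>+v. ennreal (start_weight G r (Suc n) v) \<partial>count_space UNIV)
      = (\<Sum>v\<in>verts G. ennreal (start_weight G r (Suc n) v))"
    by (rule nn_integral_count_space') (auto simp: start_weight_outside)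
  ultimately show ?thesis using nonneg by (simp add: sum_ennreal)
qed

lemma pmf_start: "pmf (embed_pmf (start_weight G r (Suc n))) v = start_weight G r (Suc n) v"
  using nn_integral_start_weight Z_pos
  by (intro pmf_embed_pmf) (auto simp: start_weight_def)

lemma set_pmf_start:
  "v \<in> set_pmf (embed_pmf (start_weight G r (Suc n))) \<Longrightarrow> bucket_size G r (Suc n) v > 0"
  by (auto simp: set_pmf_iff pmf_start start_weight_def split: if_splits)

lemma set_pmf_sample: "set_pmf sample \<subseteq> graphlets G (Suc n)"
proof
  fix S assume "S \<in> set_pmf sample"
  then obtain v where v: "bucket_size G r (Suc n) v > 0"
    and S: "S \<in> set_pmf (grow (upper_graph G r v) n {v})"
    by (auto simp: sample_graphlet_def dest: set_pmf_start)
  \<comment> \<open>Positive start weight provides a graphlet containing \<open>v\<close>, the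
    witness that growth from \<open>v\<close> never meets an empty cut.\<close>
  obtain W where W: "W \<in> bucket G r (Suc n) v"
    using v by (auto simp: bucket_size_eq card_gt_0_iff)
  have Wg: "W \<in> graphlets (upper_graph G r v) (Suc n)" "v \<in> W" using W by (auto simp: bucket_def)
  note Wg' = graphletsD[OF Wg(1)]
  have "S \<subseteq> verts (upper_graph G r v) \<and> v \<in> S \<and> card S = card W \<and> connected (upper_graph G r v \<restriction> S)"
    using Wg Wg' S
    by (intro set_pmf_grow[OF graph_upper_graph[OF graph]]) (auto simp: connected_singleton)
  then have "S \<in> bucket G r (Suc n) v" using Wg' by (auto simp: bucket_def graphlets_def)
  then show "S \<in> graphlets G (Suc n)" by (simp add: in_bucket_iff)
qed

lemma pmf_sample_ge:
  assumes S: "S \<in> graphlets G (Suc n)"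
  shows "pmf sample S \<ge> 1 / inv_pmf_bound"
proof -
  obtain v where v: "v \<in> verts G" "S \<in> bucket G r (Suc n) v"
    using graphlet_in_bucket[OF order finite_verts S] by blast
  define d where "d = real (upper_degree G r v v)"
  define D where "D = (1 + \<epsilon>) * d"
  have d: "d \<ge> 1" using upper_degree_pos[OF graph v(2)] n by (simp add: d_def)
  have Sg: "S \<in> graphlets (upper_graph G r v) (Suc n)" "v \<in> S" using v by (auto simp: bucket_def)
  note Sg' = graphletsD[OF Sg(1)]
  interpret H: graph "upper_graph G r v" by (rule graph_upper_graph[OF graph])
  \<comment> \<open>The DD condition at the least vertex \<open>v\<close> bounds every degree in its
    upper graph, since \<open>d \<ge> 1\<close>.\<close>
  have degree: "real (out_degree (upper_graph G r v) u) \<le> D" if "u \<in> S" for u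
  proof -
    have u: "u \<in> verts G" "(v, u) \<in> r" using v that by (auto simp: in_bucket_iff graphlets_def)
    then have "d \<ge> 1 / (1 + \<epsilon>) * real (upper_degree G r v u)"
      using dd v d by (auto simp: dd_order_def d_def)
    then show ?thesis using eps by (simp add: D_def upper_degree_def field_simps)
  qed
  \<comment> \<open>The growing set has sizes \<open>1\<close> to \<open>n\<close> when an arc is
    drawn, which yields \<open>fact n\<close>.\<close>
  have fact: "(\<Prod>j = 1..<Suc n. real j * D) = fact n * D ^ n"
    by (simp add: prod.distrib fact_prod atLeastLessThanSuc_atLeastAtMost)
  have "1 / (fact n * D ^ n) \<le> pmf (grow (upper_graph G r v) n {v}) S"
    using pmf_grow_ge[OF H.graph_axioms Sg'(3) _ degree, of "{v}" n] Sg Sg' fact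
    by (auto simp: finite_subset)
  moreover have "start_weight G r (Suc n) v = d ^ n / Z"
    using bucket_size_pos[OF v(2)] by (simp add: start_weight_def d_def)
  moreover have "start_weight G r (Suc n) v * pmf (grow (upper_graph G r v) n {v}) S \<le> pmf sample S"
    using pmf_bind_ge[of "embed_pmf (start_weight G r (Suc n))" v]
    by (simp add: pmf_start sample_graphlet_def)
  ultimately have "d ^ n / Z * (1 / (fact n * D ^ n)) \<le> pmf sample S"
    using d Z_pos by (smt (verit) divide_nonneg_pos mult_left_mono zero_le_power)
  moreover have "d ^ n / Z * (1 / (fact n * D ^ n)) = 1 / inv_pmf_bound"
    using d by (simp add: D_def inv_pmf_bound_def power_mult_distrib)
  ultimately show ?thesis by simp
qed

lemma inv_pmf_bound_le:
  "inv_pmf_bound \<le> fact n * real n ^ n * (1 + \<epsilon>) ^ n * real (card (graphlets G (Suc n)))"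
proof -
  have "inv_pmf_bound \<le> (real n ^ n * real (card (graphlets G (Suc n)))) * fact n * (1 + \<epsilon>) ^ n"
    unfolding inv_pmf_bound_def using eps
    by (intro mult_right_mono start_norm_le[OF graph order]) auto
  then show ?thesis by (simp add: mult_ac)
qed

lemma pmf_sample_pos: "S \<in> graphlets G (Suc n) \<Longrightarrow> pmf sample S > 0"
  using pmf_sample_ge inv_pmf_bound_pos by (meson less_le_trans zero_less_divide_1_iff)

lemma inv_pmf_sample_le: "S \<in> graphlets G (Suc n) \<Longrightarrow> 1 / pmf sample S \<le> inv_pmf_bound"
  using pmf_sample_ge[of S] pmf_sample_pos[of S] inv_pmf_bound_pos by (simp add: field_simps)

text \<open>Inverse-probability weighting: every graphlet has positive probability, so its term
  \<open>p(S) * (1/p(S))\<close> is exactly 1.\<close>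

lemma expectation_inv_pmf:
  "measure_pmf.expectation sample (\<lambda>S. if P S then 1 / pmf sample S else 0)
     = real (card {S \<in> graphlets G (Suc n). P S})"
proof -
  have fin: "finite (graphlets G (Suc n))" by (rule finite_graphlets) simp
  have "measure_pmf.expectation sample (\<lambda>S. if P S then 1 / pmf sample S else 0)
      = (\<Sum>S\<in>graphlets G (Suc n). pmf sample S * (if P S then 1 / pmf sample S else 0))"
    using set_pmf_sample by (subst integral_measure_pmf[OF fin]) auto
  also have "\<dots> = (\<Sum>S\<in>graphlets G (Suc n). if P S then 1 else 0)"
    using pmf_sample_pos by (intro sum.cong) fastforce+
  finally show ?thesis using fin by (simp add: sum.If_cases Collect_conj_eq Int_commute)
qed

end

subsection \<open>Concentration of the counters\<close>

text \<open>Unrolls the sequential loop into a function of one product distribution, where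
  independence of the samples is available. Coordinates outside \<open>{..<T}\<close> carry the
  default \<open>undefined\<close>.\<close>

lemma counters_conv_Pi_pmf:
  "counters G r k m g T
     = map_pmf (\<lambda>x j. \<Sum>i<T. if graphlet_index G m g (x i) = j
                         then 1 / pmf (sample_graphlet G r k) (x i) else 0)
         (Pi_pmf {..<T} undefined (\<lambda>_. sample_graphlet G r k))"
proof (induction T)
  case (Suc T)
  let ?p = "sample_graphlet G r k"
  let ?h = "\<lambda>S j. if graphlet_index G m g S = j then 1 / pmf ?p S else 0"
  let ?P = "Pi_pmf {..<T} undefined (\<lambda>_. ?p)"
  \<comment> \<open>Updating one counter equals adding \<open>?h S\<close> to all of them, and
    storing \<open>S\<close> at position \<open>T\<close> leaves the earlier samples intact.\<close>
  have upd: "(\<lambda>j. \<Sum>i<T. ?h (x i) j)(graphlet_index G m g S :=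
           (\<Sum>i<T. ?h (x i) (graphlet_index G m g S)) + 1 / pmf ?p S)
      = (\<lambda>j. \<Sum>i<Suc T. ?h ((x(T := S)) i) j)" for x S
    by (auto simp: fun_eq_iff intro!: sum.cong)
  have "counters G r k m g (Suc T)
      = do { x \<leftarrow> ?P; S \<leftarrow> ?p; return_pmf (\<lambda>j. \<Sum>i<Suc T. ?h ((x(T := S)) i) j) }"
    by (simp only: counters.simps Suc.IH map_pmf_def bind_assoc_pmf bind_return_pmf Let_def upd)
  \<comment> \<open>The new sample is drawn first, to match the decomposition of
    \<open>Pi_pmf\<close> over an inserted index.\<close>
  also have "\<dots> = do { S \<leftarrow> ?p; x \<leftarrow> ?P; return_pmf (\<lambda>j. \<Sum>i<Suc T. ?h ((x(T := S)) i) j) }"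
    by (rule bind_commute_pmf)
  also have "\<dots> = map_pmf (\<lambda>x j. \<Sum>i<Suc T. ?h (x i) j)
      (do { S \<leftarrow> ?p; x \<leftarrow> ?P; return_pmf (x(T := S)) })"
    by (simp only: map_pmf_def bind_assoc_pmf bind_return_pmf)
  also have "(do { S \<leftarrow> ?p; x \<leftarrow> ?P; return_pmf (x(T := S)) })
      = Pi_pmf {..<Suc T} undefined (\<lambda>_. ?p)"
    unfolding lessThan_Suc by (rule Pi_pmf_insert'[symmetric]) auto
  finally show ?case .
qed simp

lemma sum_iid_concentration:
  fixes p :: "'s pmf" and h :: "'s \<Rightarrow> real"
  assumes h: "\<And>x. x \<in> set_pmf p \<Longrightarrow> 0 \<le> h x \<and> h x \<le> b" and b: "b > 0" and T: "T > 0" and \<beta>: "\<beta> \<ge> 0"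
  shows "measure_pmf.prob (Pi_pmf {..<T} d (\<lambda>_. p))
           {x. \<bar>(\<Sum>i<T. h (x i)) / real T - measure_pmf.expectation p h\<bar> \<ge> \<beta>}
         \<le> 2 * exp (- 2 * real T * \<beta>\<^sup>2 / b\<^sup>2)"
proof -
  let ?P = "Pi_pmf {..<T} d (\<lambda>_. p)"
  have comp: "map_pmf (\<lambda>x. x i) ?P = p" if "i < T" for i
    using that by (subst Pi_pmf_component) auto
  \<comment> \<open>Coordinate 0, present because \<open>T > 0\<close>, serves as the reference copy
    of the common distribution.\<close>
  interpret Hoeffding_ineq_iid "measure_pmf ?P" "{..<T}" "\<lambda>i x. h (x i)" "\<lambda>x. h (x 0)" 0 b
    "measure_pmf.expectation ?P (\<lambda>x. h (x 0))"
  proof unfold_locales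
    show "prob_space.indep_vars (measure_pmf ?P) (\<lambda>_. borel) (\<lambda>i x. h (x i)) {..<T}"
      by (rule prob_space.indep_vars_compose2[OF measure_pmf.prob_space_axioms indep_vars_Pi_pmf]) auto
    show "distr (measure_pmf ?P) borel (\<lambda>x. h (x i)) = distr (measure_pmf ?P) borel (\<lambda>x. h (x 0))"
      if "i \<in> {..<T}" for i
    proof -
      have "distr (measure_pmf ?P) borel (\<lambda>x. h (x j)) = distr (measure_pmf p) borel h" if "j < T" for j
      proof -
        have "distr (measure_pmf p) borel h = distr (measure_pmf (map_pmf (\<lambda>x. x j) ?P)) borel h"
          by (simp only: comp[OF that])
        also have "\<dots> = distr (measure_pmf ?P) borel (\<lambda>x. h (x j))"
          by (subst map_pmf_rep_eq, subst distr_distr) (auto simp: o_def)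
        finally show ?thesis by simp
      qed
      then show ?thesis using that T by simp
    qed
    have "x 0 \<in> set_pmf p" if "x \<in> set_pmf ?P" for x
      using that T by (auto simp: set_Pi_pmf PiE_dflt_def)
    then show "AE x in measure_pmf ?P. h (x 0) \<in> {0..b}"
      using h by (auto simp: AE_measure_pmf_iff)
  qed auto
  have "measure_pmf.expectation ?P (\<lambda>x. h (x 0)) = measure_pmf.expectation (map_pmf (\<lambda>x. x 0) ?P) h"
    by simp
  also have "\<dots> = measure_pmf.expectation p h" using T by (simp only: comp)
  finally have mean: "measure_pmf.expectation ?P (\<lambda>x. h (x 0)) = measure_pmf.expectation p h" .
  have "{..<T} \<noteq> {}" using T by auto
  from Hoeffding_ineq_abs_ge'[OF \<beta> b this] show ?thesis
    unfolding mean by (simp only: card_lessThan space_measure_pmf UNIV_I simp_thms diff_zero)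
qed

context dd_sampling
begin

text \<open>Exchanging the sums over \<open>J\<close> and over samples gives a sum of
  \<open>T\<close> independent terms, since a sample feeds only the counter of its own
  index.\<close>

lemma counters_concentration:
  fixes g :: "nat \<Rightarrow> (nat, nat \<times> nat) pre_digraph"
  assumes g: "graphlet_representatives (Suc n) m g" and J: "J \<subseteq> {1..m}" and T: "T > 0" and \<beta>: "\<beta> \<ge> 0"
  shows "measure_pmf.prob (counters G r (Suc n) m g T)
           {c. \<bar>(\<Sum>j\<in>J. c j) / real T - real (\<Sum>j\<in>J. graphlet_count G (Suc n) (g j))\<bar> \<ge> \<beta>}
         \<le> 2 * exp (- 2 * real T * \<beta>\<^sup>2 / inv_pmf_bound\<^sup>2)"
proof -
  define h where "h = (\<lambda>S. if graphlet_index G m g S \<in> J then 1 / pmf sample S else 0)"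
  have "finite J" using J finite_subset by auto
  then have swap: "(\<Sum>j\<in>J. \<Sum>i<T. if graphlet_index G m g (x i) = j then 1 / pmf sample (x i) else 0)
      = (\<Sum>i<T. h (x i))" for x
    by (subst sum.swap) (simp add: h_def)
  have "0 \<le> h S \<and> h S \<le> inv_pmf_bound" if "S \<in> set_pmf sample" for S
    using that set_pmf_sample inv_pmf_sample_le[of S] inv_pmf_bound_pos by (auto simp: h_def)
  note sum_iid_concentration[of sample h, OF this inv_pmf_bound_pos T \<beta>, where d = undefined]
  moreover have "measure_pmf.expectation sample h = real (\<Sum>j\<in>J. graphlet_count G (Suc n) (g j))"
    unfolding h_def expectation_inv_pmf sum_graphlet_count[OF graph g J] ..
  ultimately show ?thesis
    unfolding counters_conv_Pi_pmf measure_map_pmf vimage_Collect_eq swap by simp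
qed

end

section \<open>Normalised estimates and the union bound\<close>

text \<open>Write \<open>a - \<mu> * b = (a - \<mu>) - \<mu> * (b - 1)\<close>, which is at most
  \<open>2\<alpha>/3\<close> in absolute value. Since \<open>\<alpha> < 1\<close>, also
  \<open>b \<ge> 2/3\<close>, and the quotient is at most \<alpha>.\<close>

lemma abs_ratio_diff_le:
  fixes a b \<mu> \<alpha> :: real
  assumes "\<bar>a - \<mu>\<bar> \<le> \<alpha> / 3" "\<bar>b - 1\<bar> \<le> \<alpha> / 3" "0 \<le> \<mu>" "\<mu> \<le> 1" "0 < \<alpha>" "\<alpha> < 1"
  shows "\<bar>a / b - \<mu>\<bar> \<le> \<alpha>"
proof -
  have b: "b \<ge> 2 / 3" using assms by linarith
  have "\<mu> * \<bar>b - 1\<bar> \<le> \<alpha> / 3"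
    using assms mult_left_le_one_le[of "\<bar>b - 1\<bar>" \<mu>] by linarith
  moreover have "\<bar>a - \<mu> * b\<bar> \<le> \<bar>a - \<mu>\<bar> + \<mu> * \<bar>b - 1\<bar>"
  proof -
    have "a - \<mu> * b = (a - \<mu>) - \<mu> * (b - 1)" by (simp add: algebra_simps)
    then show ?thesis
      using abs_triangle_ineq4[of "a - \<mu>" "\<mu> * (b - 1)"] assms(3) by (simp add: abs_mult)
  qed
  ultimately have "\<bar>a - \<mu> * b\<bar> \<le> \<alpha> * (2 / 3)" using assms(1) by linarith
  also have "\<dots> \<le> \<alpha> * b" using b assms by (intro mult_left_mono) auto
  finally have "\<bar>a - \<mu> * b\<bar> / b \<le> \<alpha>" using b by (simp add: divide_le_eq)
  moreover have "a / b - \<mu> = (a - \<mu> * b) / b" using b by (simp add: field_simps)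
  ultimately show ?thesis using b by simp
qed

text \<open>There are at most \<open>M + 1\<close> events to exclude, and \<open>R\<close> is the
  ratio by which \<open>B\<close> may exceed \<open>L\<close>. The sample size makes each exponent
  at least \<open>ln (4 * M / \<delta>)\<close>.\<close>

lemma failure_bound:
  fixes \<alpha> \<delta> B L R M :: real
  assumes "0 < \<alpha>" "\<alpha> < 1" "0 < \<delta>" "\<delta> < 1" "M \<ge> 1" "0 < B" "B \<le> R * L" "0 < R" "0 < L"
    and T: "T \<ge> 12 * R\<^sup>2 / (\<alpha>\<^sup>2 * (1 - \<alpha>)\<^sup>2) * ln (4 * M / \<delta>)"
  shows "(M + 1) * (2 * exp (- 2 * T * (\<alpha> / 3 * L)\<^sup>2 / B\<^sup>2)) \<le> \<delta>"
proof -
  let ?l = "ln (4 * M / \<delta>)"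
  have "4 * M / \<delta> \<ge> 1" using assms by (simp add: field_simps)
  then have l: "?l \<ge> 0" by simp
  have "12 * R\<^sup>2 / \<alpha>\<^sup>2 * ?l \<le> 12 * R\<^sup>2 / (\<alpha>\<^sup>2 * (1 - \<alpha>)\<^sup>2) * ?l"
  proof (intro mult_right_mono[OF _ l] divide_left_mono)
    have "(1 - \<alpha>)\<^sup>2 \<le> 1" using assms by (intro power_le_one) auto
    then show "\<alpha>\<^sup>2 * (1 - \<alpha>)\<^sup>2 \<le> \<alpha>\<^sup>2" using assms by (simp add: mult_left_le)
  qed (use assms in auto)
  with T have T': "T \<ge> 12 * R\<^sup>2 / \<alpha>\<^sup>2 * ?l" by linarith
  then have "T \<ge> 0" using l by (smt (verit) divide_nonneg_nonneg mult_nonneg_nonneg zero_le_power2)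
  \<comment> \<open>The factor \<open>2/9\<close> is Hoeffding's 2 times the square of
    \<open>1/3\<close> from the deviation; multiplied by 12 it exceeds 1.\<close>
  have "?l \<le> 2 / 9 * 12 * ?l" using l by simp
  also have "\<dots> = 2 * (12 * R\<^sup>2 / \<alpha>\<^sup>2 * ?l) * (\<alpha> / 3 * L)\<^sup>2 / (R * L)\<^sup>2"
    using assms by (simp add: field_simps power2_eq_square)
  also have "\<dots> \<le> 2 * T * (\<alpha> / 3 * L)\<^sup>2 / (R * L)\<^sup>2"
    using T' by (intro divide_right_mono mult_right_mono mult_left_mono) auto
  also have "\<dots> \<le> 2 * T * (\<alpha> / 3 * L)\<^sup>2 / B\<^sup>2"
    using assms \<open>T \<ge> 0\<close> by (intro divide_left_mono power_mono) auto
  finally have "exp (- (2 * T * (\<alpha> / 3 * L)\<^sup>2 / B\<^sup>2)) \<le> exp (- ?l)" by simp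
  also have "exp (- ?l) = \<delta> / (4 * M)" using assms by (simp add: exp_minus)
  finally have "(M + 1) * (2 * exp (- 2 * T * (\<alpha> / 3 * L)\<^sup>2 / B\<^sup>2)) \<le> (M + 1) * (2 * (\<delta> / (4 * M)))"
    using assms by (intro mult_left_mono) auto
  \<comment> \<open>Each event has probability at most \<open>\<delta> / (2 * M)\<close>, and
    \<open>M + 1 \<le> 2 * M\<close>.\<close>
  also have "\<dots> \<le> \<delta>" using assms by (simp add: field_simps)
  finally show ?thesis .
qed

theorem theorem7:
  fixes G :: "('a, 'b) pre_digraph" and r :: "'a rel" and k m T :: nat
    and g :: "nat \<Rightarrow> (nat, nat \<times> nat) pre_digraph"
    and \<epsilon> \<alpha> \<delta> :: real
  assumes "Digraph.graph G"
    and "k \<ge> 3"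
    and "graphlet_representatives k m g"
    and "graphlets G k \<noteq> {}"
    and "\<epsilon> > 0"
    and "dd_order (1 / (1 + \<epsilon>)) G r"
    and "0 < \<alpha>" and "\<alpha> < 1" and "0 < \<delta>" and "\<delta> < 1"
    and "T > 0"
    and "real T \<ge> 12 * (fact (k - 1))^2 * real (k - 1) ^ (2 * k - 2) * (1 + \<epsilon>) ^ (2 * k - 2)
                    / (\<alpha>^2 * (1 - \<alpha>)^2) * ln (4 * real m / \<delta>)"
  shows "measure_pmf.prob (estimate G r k m g T)
           {\<mu>'. \<forall>i\<in>{1..m}. \<bar>\<mu>' i - graphlet_distribution G k m g i\<bar> \<le> \<alpha>} \<ge> 1 - \<delta>"
proof -
  define n where "n = k - 1"
  have k: "k = Suc n" and n: "n \<ge> 2" using \<open>k \<ge> 3\<close> by (auto simp: n_def)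
  note g = assms(3)[unfolded k]
  interpret dd_sampling G r n \<epsilon>
    using assms n by (intro dd_sampling.intro) (auto simp: k)
  let ?l = "\<lambda>J. real (\<Sum>j\<in>J. graphlet_count G k (g j))"
  define L where "L = real (card (graphlets G k))"
  define R where "R = fact n * real n ^ n * (1 + \<epsilon>) ^ n"
  define bad where "bad J = {c. \<bar>(\<Sum>j\<in>J. c j) / real T - ?l J\<bar> \<ge> \<alpha> / 3 * L}" for J
  \<comment> \<open>The singletons control the individual counters and \<open>{1..m}\<close> their
    sum. For \<open>m = 1\<close> the two coincide, so \<open>card Js\<close> is only bounded by
    \<open>m + 1\<close>.\<close>
  define Js where "Js = insert {1..m} ((\<lambda>i. {i}) ` {1..m})"
  let ?C = "counters G r k m g T"
  have L: "L > 0"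
    using graphlets_ne finite_graphlets[of G] by (simp add: L_def k card_gt_0_iff)
  have total: "?l {1..m} = L"
  proof -
    have "{S \<in> graphlets G k. graphlet_index G m g S \<in> {1..m}} = graphlets G k"
      using graphlet_index_in[OF graph assms(3)] by blast
    then show ?thesis by (simp add: L_def sum_graphlet_count[OF graph assms(3)])
  qed
  \<comment> \<open>The index of any existing graphlet lies in \<open>{1..m}\<close>.\<close>
  have m: "m \<ge> 1"
    using graphlets_ne graphlet_index_in[OF graph g] by fastforce
  have T: "real T \<ge> 12 * R\<^sup>2 / (\<alpha>\<^sup>2 * (1 - \<alpha>)\<^sup>2) * ln (4 * real m / \<delta>)"
    using assms(12) by (simp add: R_def k power_mult_distrib power_mult mult_ac power_commutes flip: power_mult)
  have "measure_pmf.prob ?C (bad J) \<le> 2 * exp (- 2 * real T * (\<alpha> / 3 * L)\<^sup>2 / inv_pmf_bound\<^sup>2)"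
    if "J \<in> Js" for J
    unfolding bad_def k using that assms L
    by (intro counters_concentration[OF g]) (auto simp: Js_def)
  then have "(\<Sum>J\<in>Js. measure_pmf.prob ?C (bad J))
      \<le> real (card Js) * (2 * exp (- 2 * real T * (\<alpha> / 3 * L)\<^sup>2 / inv_pmf_bound\<^sup>2))"
    by (rule sum_bounded_above)
  also have "\<dots> \<le> (real m + 1) * (2 * exp (- 2 * real T * (\<alpha> / 3 * L)\<^sup>2 / inv_pmf_bound\<^sup>2))"
  proof -
    have "card Js \<le> Suc (card ((\<lambda>i. {i}) ` {1..m}))" unfolding Js_def by (rule card_insert_le_m1) auto
    also have "\<dots> \<le> m + 1" using card_image_le[of "{1..m}" "\<lambda>i. {i}"] by simp
    finally show ?thesis by (intro mult_right_mono) auto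
  qed
  also have "\<dots> \<le> \<delta>"
  proof (rule failure_bound[OF assms(7-10)])
    show "inv_pmf_bound \<le> R * L" using inv_pmf_bound_le by (simp add: R_def L_def k)
    show "R > 0" using n eps by (simp add: R_def)
  qed (use m L T inv_pmf_bound_pos in auto)
  finally have "measure_pmf.prob ?C (\<Union>J\<in>Js. bad J) \<le> \<delta>"
    by (rule order_trans[OF measure_pmf.finite_measure_subadditive_finite[of Js], rotated 2])
       (auto simp: Js_def)
  \<comment> \<open>Outside all bad events the rest of the argument is deterministic.\<close>
  then have "1 - \<delta> \<le> measure_pmf.prob ?C (- (\<Union>J\<in>Js. bad J))"
    using measure_pmf.prob_compl[of "\<Union>J\<in>Js. bad J" ?C] by (simp add: Compl_eq_Diff_UNIV)
  also have "\<dots> \<le> measure_pmf.prob ?C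
      {c. \<forall>i\<in>{1..m}. \<bar>c i / (\<Sum>j=1..m. c j) - graphlet_distribution G k m g i\<bar> \<le> \<alpha>}"
  proof (intro measure_pmf.finite_measure_mono subsetI CollectI ballI)
    fix c i assume c: "c \<in> - (\<Union>J\<in>Js. bad J)" and i: "i \<in> {1..m}"
    let ?s = "\<Sum>j=1..m. c j"
    have scale: "\<bar>x / (real T * L) - y / L\<bar> \<le> \<alpha> / 3"
      if "\<not> \<bar>x / real T - y\<bar> \<ge> \<alpha> / 3 * L" for x y
    proof -
      have "x / (real T * L) - y / L = (x / real T - y) / L" by (simp add: diff_divide_distrib)
      then show ?thesis using that L by (simp add: abs_divide divide_le_eq)
    qed
    have ci: "\<bar>c i / (real T * L) - ?l {i} / L\<bar> \<le> \<alpha> / 3"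
      using c i by (intro scale) (auto simp: Js_def bad_def)
    have sum: "\<bar>?s / (real T * L) - 1\<bar> \<le> \<alpha> / 3"
      using scale[of ?s L] c L total by (auto simp: Js_def bad_def)
    have "?l {i} \<le> ?l {1..m}"
      using i by (intro of_nat_mono sum_mono2) auto
    then have "?l {i} / L \<le> 1" using L by (simp only: total divide_le_eq_1_pos)
    \<comment> \<open>Numerator and denominator are both scaled by \<open>T * L\<close>, so that
      they approximate \<open>\<mu>\<close> and 1; the scaling cancels in the ratio.\<close>
    then have "\<bar>(c i / (real T * L)) / (?s / (real T * L)) - ?l {i} / L\<bar> \<le> \<alpha>"
      using L by (intro abs_ratio_diff_le[OF ci sum _ _ assms(7,8)]) simp_all
    moreover have "(c i / (real T * L)) / (?s / (real T * L)) = c i / ?s"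
      using L \<open>T > 0\<close> by simp
    moreover have "graphlet_distribution G k m g i = ?l {i} / L"
      using total by (simp add: graphlet_distribution_def)
    ultimately show "\<bar>c i / ?s - graphlet_distribution G k m g i\<bar> \<le> \<alpha>" by (simp only:)
  qed auto
  finally show ?thesis
    by (simp add: estimate_def vimage_Collect_eq)
qed

end
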